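(* Let $n\ge1$ and let $\boldsymbol{k}=(k_1,\dots,k_\ell)$ be integers with $0<k_1<\cdots<k_\ell\le n$. With respect to the positive structure on $\mathrm{Sp}_{2n}(\mathbf R)$ relative to $\Theta=\{\alpha_n\}$, the positive part $\mathsf{F}^{\mathrm{Sp}}_{\boldsymbol{k}}(\mathbf{R}^{2n})^{>0}$ (resp. the non-negative part $\mathsf{F}^{\mathrm{Sp}}_{\boldsymbol{k}}(\mathbf{R}^{2n})^{\geq 0}$) consists of those isotropic flags $(E_1, \dots, E_\ell)\in \mathsf{F}^{\mathrm{Sp}}_{\boldsymbol{k}}(\mathbf{R}^{2n})$ for which $\mathbb{P}(E_\ell) \subset \mathcal{H}^{>0}$ (resp. $\mathbb{P}(E_\ell) \subset \mathcal{H}^{\geq 0}$).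
   Context: On $\mathbf R^{2n}$ with coordinates $(x_1,\dots,x_n,y_1,\dots,y_n)$ let $\omega=\sum_{i=1}^n dx_i\wedge dy_i$, and $\mathrm{Sp}_{2n}(\mathbf R)$ its isometry group. $L_0=\{y=0\}$ and $L_\infty=\{x=0\}$ are transverse Lagrangians, $\mathbf R^{2n}=L_0\oplus L_\infty$; write $v=v_0+v_\infty$ accordingly and let $q(v)=\omega(v_0,v_\infty)$, a quadratic form of signature $(n,n)$. Set $\mathcal H^{>0}=\mathbb P(\{v\in\mathbf R^{2n}\mid q(v)>0\})$ and $\mathcal H^{\ge0}=\mathbb P(\{v\in\mathbf R^{2n}\smallsetminus\{0\}\mid q(v)\ge0\})$, subsets of $\mathbb P(\mathbf R^{2n})$. For the positive structure relative to $\Theta=\{\alpha_n\}$ (here $P_\Theta$, $P_\Theta^{\mathrm{opp}}$ are the stabilizers of $L_0$, $L_\infty$): $L_\Theta^\circ$ is the group of matrices $\begin{pmatrix}A&0\\0&(A^T)^{-1}\end{pmatrix}$, $A\in\mathrm{GL}_n(\mathbf R)$, $\det A>0$; $U_\Theta^{>0}$ is the set of matrices $\begin{pmatrix}\mathrm{Id}&M\\0&\mathrm{Id}\end{pmatrix}$ and $U_\Theta^{\mathrm{opp}>0}$ the set of matrices $\begin{pmatrix}\mathrm{Id}&0\\N&\mathrm{Id}\end{pmatrix}$ with $M,N$ symmetric positive definite; the non-negative semigroups $U_\Theta^{\geq 0}$, $U_\Theta^{\mathrm{opp}\ge0}$ are defined by positive semidefinite $M,N$. $G_\Theta^{\ge0}$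 is the semigroup generated by $U_\Theta^{\ge0},L_\Theta^\circ,U_\Theta^{\mathrm{opp}\ge0}$, and $G_\Theta^{>0}$ is its interior in $\mathrm{Sp}_{2n}(\mathbf R)$; one has $G_\Theta^{>0}=U_\Theta^{\mathrm{opp}>0}L_\Theta^\circ U_\Theta^{>0}$. $\mathsf{F}^{\mathrm{Sp}}_{\boldsymbol{k}}(\mathbf{R}^{2n})$ is the space of flags $E_1\subset\cdots\subset E_\ell$ of isotropic subspaces of $\mathbf R^{2n}$ with $\dim E_i=k_i$. Its positive part is $\mathsf{F}^{\mathrm{Sp}}_{\boldsymbol{k}}(\mathbf{R}^{2n})^{>0}=\{g\cdot(F_1,\dots,F_\ell)\mid g\in G_\Theta^{>0},\ F_1\subset\cdots\subset F_\ell\subset L_0,\ \dim F_i=k_i\}$, and its non-negative part $\mathsf{F}^{\mathrm{Sp}}_{\boldsymbol{k}}(\mathbf{R}^{2n})^{\ge0}$ is the closure of the positive part in $\mathsf{F}^{\mathrm{Sp}}_{\boldsymbol{k}}(\mathbf{R}^{2n})$. *)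

theory Defs
  imports "HOL-Analysis.Analysis"
begin

text \<open>
  The space \<open>\<real>\<^sup>2\<^sup>n\<close> is \<open>real ^ ('n + 'n)\<close> with \<open>n = CARD('n)\<close>; the coordinate \<open>x\<^sub>i\<close> of \<open>v\<close> is
  \<open>v $ Inl i\<close> and \<open>y\<^sub>i\<close> is \<open>v $ Inr i\<close>.
\<close>

type_synonym 'n dvec = "real ^ ('n + 'n)"
type_synonym 'n dmat = "real ^ ('n + 'n) ^ ('n + 'n)"

definition omega :: "'n::finite dvec \<Rightarrow> 'n dvec \<Rightarrow> real" where
  "omega v w = (\<Sum>i\<in>UNIV. v $ Inl i * w $ Inr i - v $ Inr i * w $ Inl i)"

definition Sp :: "'n::finite dmat set" where
  "Sp = {g. \<forall>v w. omega (g *v v) (g *v w) = omega v w}"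

definition L_0 :: "'n::finite dvec set" where
  "L_0 = {v. \<forall>i. v $ Inr i = 0}"

definition L_inf :: "'n::finite dvec set" where
  "L_inf = {v. \<forall>i. v $ Inl i = 0}"

definition part_0 :: "'n::finite dvec \<Rightarrow> 'n dvec" where
  "part_0 v = (\<chi> s. case s of Inl i \<Rightarrow> v $ Inl i | Inr i \<Rightarrow> 0)"

definition part_inf :: "'n::finite dvec \<Rightarrow> 'n dvec" where
  "part_inf v = (\<chi> s. case s of Inl i \<Rightarrow> 0 | Inr i \<Rightarrow> v $ Inr i)"

lemma decomposition_L_0_L_inf:
  "part_0 v \<in> L_0" "part_inf v \<in> L_inf" "part_0 v + part_inf v = v"
  by (auto simp: part_0_def part_inf_def L_0_def L_inf_def vec_eq_iff split: sum.splits)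

definition q :: "'n::finite dvec \<Rightarrow> real" where
  "q v = omega (part_0 v) (part_inf v)"

text \<open>Points of the projective space are the lines \<open>span {v}\<close> with \<open>v \<noteq> 0\<close>.\<close>

definition proj :: "'a::real_vector set \<Rightarrow> 'a set set" where
  "proj S = (\<lambda>v. span {v}) ` (S - {0})"

definition H_pos :: "'n::finite dvec set set" where
  "H_pos = proj {v. q v > 0}"

definition H_nonneg :: "'n::finite dvec set set" where
  "H_nonneg = proj {v. v \<noteq> 0 \<and> q v \<ge> 0}"

definition block :: "real^'n^'n \<Rightarrow> real^'n^'n \<Rightarrow> real^'n^'n \<Rightarrow> real^'n^'n \<Rightarrow> 'n::finite dmat" where
  "block A B C D = (\<chi> r c. case r of
      Inl i \<Rightarrow> (case c of Inl j \<Rightarrow> A $ i $ j | Inr j \<Rightarrow> B $ i $ j)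
    | Inr i \<Rightarrow> (case c of Inl j \<Rightarrow> C $ i $ j | Inr j \<Rightarrow> D $ i $ j))"

definition sym_pos_semidef :: "real^'n^'n \<Rightarrow> bool" where
  "sym_pos_semidef M \<longleftrightarrow> transpose M = M \<and> (\<forall>x. x \<bullet> (M *v x) \<ge> 0)"

definition L_Theta :: "'n::finite dmat set" where
  "L_Theta = {block A 0 0 (matrix_inv (transpose A)) | A. det A > 0}"

definition U_nonneg :: "'n::finite dmat set" where
  "U_nonneg = {block (mat 1) M 0 (mat 1) | M. sym_pos_semidef M}"

definition Uopp_nonneg :: "'n::finite dmat set" where
  "Uopp_nonneg = {block (mat 1) 0 N (mat 1) | N. sym_pos_semidef N}"

inductive_set G_nonneg :: "'n::finite dmat set" where
  generator: "g \<in> U_nonneg \<union> L_Theta \<union> Uopp_nonneg \<Longrightarrow> g \<in> G_nonneg"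
| mult: "g \<in> G_nonneg \<Longrightarrow> h \<in> G_nonneg \<Longrightarrow> g ** h \<in> G_nonneg"

definition G_pos :: "'n::finite dmat set" where
  "G_pos = top_of_set Sp interior_of G_nonneg"

text \<open>A flag is the list of its members; \<open>map dim E = k\<close> also fixes its length.\<close>

definition isotropic :: "'n::finite dvec set \<Rightarrow> bool" where
  "isotropic V \<longleftrightarrow> (\<forall>v\<in>V. \<forall>w\<in>V. omega v w = 0)"

definition flags :: "nat list \<Rightarrow> 'n::finite dvec set list set" where
  "flags k = {E. (\<forall>V\<in>set E. subspace V \<and> isotropic V) \<and> sorted_wrt (\<subseteq>) E \<and> map dim E = k}"

definition flags_pos :: "nat list \<Rightarrow> 'n::finite dvec set list set" where
  "flags_pos k = {map (\<lambda>V. (*v) g ` V) F | g F.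
     g \<in> G_pos \<and> (\<forall>V\<in>set F. subspace V \<and> V \<subseteq> L_0) \<and> sorted_wrt (\<subseteq>) F \<and> map dim F = k}"

text \<open>
  The usual topology of a Grassmannian is the one induced by sending a subspace \<open>V\<close> to the
  matrix of the orthogonal projection onto \<open>V\<close>, which is \<open>closest_point V\<close>.  Flags carry the
  topology they inherit from the product of the Grassmannians of their members; the value \<open>0\<close>
  beyond the length of the list is padding.
\<close>

definition flag_projections :: "'n::finite dvec set list \<Rightarrow> nat \<Rightarrow> 'n dmat" where
  "flag_projections E = (\<lambda>i. if i < length E then matrix (closest_point (E ! i)) else 0)"

definition flag_topology :: "nat list \<Rightarrow> 'n::finite dvec set list topology" where
  "flag_topology k = pullback_topology (flags k) flag_projections euclidean"

definition flags_nonneg :: "nat list \<Rightarrow> 'n::finite dvec set list set" where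
  "flags_nonneg k = flag_topology k closure_of flags_pos k"

end

theory Submission
  imports Defs
begin

text \<open>
  In coordinates \<open>q v = x \<bullet> y\<close>, and every generator of \<^const>\<open>G_nonneg\<close> increases \<open>q\<close> weakly.  The
  elements \<open>shear t = u\<^sup>o\<^sup>p\<^sup>p(t) u(t)\<close> with \<open>t > 0\<close> increase \<open>q\<close> strictly off the origin, and an interior
  point of the semigroup factors as \<open>shear t\<close> times another element of the semigroup; hence
  \<^const>\<open>G_pos\<close> maps \<^const>\<open>L_0\<close> to subspaces on which \<open>q > 0\<close>.  Conversely, an isotropic subspace on
  which \<open>q > 0\<close> lies in the graph \<open>y = N x\<close> of a symmetric positive definite \<open>N\<close>, and this graph is
  the image of \<^const>\<open>L_0\<close> under \<open>u\<^sup>o\<^sup>p\<^sup>p(N) u(1) \<in> G_pos\<close>.  For the closure, \<open>q \<ge> 0\<close> is a closed condition,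
  and if \<open>q \<ge> 0\<close> on the last member of a flag \<open>E\<close> then the flags \<open>shear t E\<close> are positive and tend to
  \<open>E\<close> as \<open>t\<close> tends to \<open>0\<close>.
\<close>

subsection \<open>Coordinates and the symplectic group\<close>

definition xc :: "'n::finite dvec \<Rightarrow> real^'n" where
  "xc v = (\<chi> i. v $ Inl i)"

definition yc :: "'n::finite dvec \<Rightarrow> real^'n" where
  "yc v = (\<chi> i. v $ Inr i)"

lemma linear_xc [simp]: "linear xc" and linear_yc [simp]: "linear yc"
  by (rule linearI; simp add: xc_def yc_def vec_eq_iff)+

lemmas xc_simps [simp] = linear_add[OF linear_xc] linear_diff[OF linear_xc] linear_0[OF linear_xc]
  linear_cmul[OF linear_xc]
lemmas yc_simps [simp] = linear_add[OF linear_yc] linear_diff[OF linear_yc] linear_0[OF linear_yc]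
  linear_cmul[OF linear_yc]

lemma dvec_eqI: "xc v = xc w \<Longrightarrow> yc v = yc w \<Longrightarrow> v = w"
  by (simp add: xc_def yc_def vec_eq_iff) (metis sumE)

lemma dvec_with_coords:
  obtains v :: "'n::finite dvec" where "xc v = x" "yc v = y"
proof
  let ?v = "(\<chi> s. case s of Inl i \<Rightarrow> x $ i | Inr i \<Rightarrow> y $ i) :: 'n dvec"
  show "xc ?v = x" "yc ?v = y" by (simp_all add: xc_def yc_def)
qed

lemma sum_sum_type: "(\<Sum>s\<in>UNIV. f s) = (\<Sum>i\<in>UNIV. f (Inl i)) + (\<Sum>i\<in>UNIV. f (Inr i))"
  for f :: "'a::finite + 'b::finite \<Rightarrow> 'c::comm_monoid_add"
  using sum.Plus[of "UNIV :: 'a set" "UNIV :: 'b set" f] by (simp add: comp_def)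

lemma omega_coords: "omega v w = xc v \<bullet> yc w - yc v \<bullet> xc w"
  by (simp add: omega_def xc_def yc_def inner_vec_def sum_subtractf)

lemma q_coords: "q v = xc v \<bullet> yc v"
  by (simp add: q_def omega_def part_0_def part_inf_def xc_def yc_def inner_vec_def)

lemma in_L_0_iff: "v \<in> L_0 \<longleftrightarrow> yc v = 0"
  by (simp add: L_0_def yc_def vec_eq_iff)

lemma inner_coords: "v \<bullet> w = xc v \<bullet> xc w + yc v \<bullet> yc w"
  by (simp add: inner_vec_def xc_def yc_def sum_sum_type)

lemma xc_block [simp]: "xc (block A B C D *v v) = A *v xc v + B *v yc v"
  and yc_block [simp]: "yc (block A B C D *v v) = C *v xc v + D *v yc v"
  by (simp_all add: xc_def yc_def block_def matrix_vector_mult_def sum_sum_type vec_eq_iff)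

lemma block_surj:
  obtains A B C D where "g = block A B C D"
proof
  show "g = block (\<chi> i j. g $ Inl i $ Inl j) (\<chi> i j. g $ Inl i $ Inr j)
    (\<chi> i j. g $ Inr i $ Inl j) (\<chi> i j. g $ Inr i $ Inr j)"
    by (auto simp: block_def vec_eq_iff split: sum.splits)
qed

lemma matrix_eqI: "(\<And>v. g *v v = h *v v) \<Longrightarrow> g = (h :: real^'a^'b)"
  by (simp add: matrix_eq)

lemma Sp_mult: "g \<in> Sp \<Longrightarrow> h \<in> Sp \<Longrightarrow> g ** h \<in> Sp"
  by (simp add: Sp_def flip: matrix_vector_mul_assoc)

text \<open>Nondegeneracy of \<open>omega\<close>: pairing \<open>v\<close> with the rotated vector
  \<open>w = (-y, x)\<close> yields \<open>omega v w = v \<bullet> v\<close>, which \<open>g\<close>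
  would send to 0.\<close>

lemma Sp_mult_eq_0:
  assumes "g \<in> Sp" "g *v v = 0"
  shows "v = 0"
proof -
  obtain w where w: "xc w = - yc v" "yc w = xc v" using dvec_with_coords by blast
  moreover have "omega (g *v v) (g *v w) = omega v w" using assms(1) by (simp add: Sp_def)
  ultimately have "v \<bullet> v = 0" by (simp add: assms(2) omega_coords inner_coords[of v v])
  then show ?thesis by simp
qed

lemma Sp_inj: "g \<in> Sp \<Longrightarrow> inj ((*v) g)"
  using Sp_mult_eq_0 by (auto simp: linear_injective_0)

lemma inner_transpose: "(transpose A *v x) \<bullet> y = x \<bullet> (A *v y)" for A :: "real^'a^'b"
  by (simp add: dot_lmul_matrix)

lemma inner_symmetric: "transpose A = A \<Longrightarrow> (A *v x) \<bullet> y = x \<bullet> (A *v y)" for A :: "real^'a^'a"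
  by (metis inner_transpose)

lemma symmetricI:
  fixes A :: "real^'a^'a"
  assumes "\<And>x y. (A *v x) \<bullet> y = x \<bullet> (A *v y)"
  shows "transpose A = A"
proof (rule matrix_eqI)
  fix x
  have "\<forall>y. (transpose A *v x) \<bullet> y = (A *v x) \<bullet> y"
    by (simp only: inner_transpose assms simp_thms)
  then show "transpose A *v x = A *v x" by (simp only: vector_eq_rdot)
qed

lemma matrix_inv_right:
  fixes A :: "real^'n^'m"
  assumes "invertible A"
  shows "A ** matrix_inv A = mat 1"
  using someI_ex[OF assms[unfolded invertible_def]] unfolding matrix_inv_def by blast

text \<open>This invariance of the pairing between the x and y coordinates is why
  \<open>L_Theta\<close> leaves \<open>q\<close> unchanged.\<close>

lemma inner_matrix_inv_transpose:
  fixes A :: "real^'n^'n"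
  assumes "invertible A"
  shows "(A *v x) \<bullet> (matrix_inv (transpose A) *v y) = x \<bullet> y"
proof -
  have "transpose A ** matrix_inv (transpose A) = mat 1"
    using assms by (simp add: matrix_inv_right invertible_det_nz)
  then show ?thesis
    by (metis inner_commute inner_transpose matrix_vector_mul_assoc matrix_vector_mul_lid)
qed

lemma upper_in_Sp: "transpose M = M \<Longrightarrow> block (mat 1) M 0 (mat 1) \<in> Sp"
  and lower_in_Sp: "transpose M = M \<Longrightarrow> block (mat 1) 0 M (mat 1) \<in> Sp"
  by (simp_all add: Sp_def omega_coords inner_add inner_symmetric)

subsection \<open>Monotonicity of \<open>q\<close>\<close>

text \<open>An upper unipotent adds \<open>y \<bullet> (M *v y)\<close> to \<open>q\<close>, a lower
  one adds \<open>x \<bullet> (N *v x)\<close>, and a Levi element adds nothing.\<close>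

lemma q_G_nonneg_mono:
  assumes "g \<in> G_nonneg"
  shows "q v \<le> q (g *v v)"
  using assms
proof (induction arbitrary: v)
  case (generator g)
  then show ?case
    by (auto simp: U_nonneg_def L_Theta_def Uopp_nonneg_def sym_pos_semidef_def q_coords inner_add
        inner_commute inner_matrix_inv_transpose invertible_det_nz)
next
  case (mult g h)
  then show ?case
    by (metis matrix_vector_mul_assoc order_trans)
qed

lemma mat_vector_mult [simp]: "mat t *v x = t *\<^sub>R x" for x :: "real^'n"
  by (simp add: matrix_vector_mult_def mat_def vec_eq_iff if_distrib if_distribR cong: if_cong)

definition shear :: "real \<Rightarrow> 'n::finite dmat" where
  "shear t = block (mat 1) 0 (mat t) (mat 1) ** block (mat 1) (mat t) 0 (mat 1)"

text \<open>The inverse of \<open>shear t\<close>, written as a product of unipotents so that it is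
  visibly symplectic and continuous in \<open>t\<close>.\<close>

definition unshear :: "real \<Rightarrow> 'n::finite dmat" where
  "unshear t = block (mat 1) (mat (- t)) 0 (mat 1) ** block (mat 1) 0 (mat (- t)) (mat 1)"

lemma shear_in_Sp: "shear t \<in> Sp" and unshear_in_Sp: "unshear t \<in> Sp"
  by (auto simp: shear_def unshear_def intro!: Sp_mult upper_in_Sp lower_in_Sp)

lemma shear_unshear: "shear t *v (unshear t *v v) = v"
  by (rule dvec_eqI) (simp_all add: shear_def unshear_def algebra_simps flip: matrix_vector_mul_assoc)

text \<open>The gain is t times the sum of the squared norms of \<open>y\<close> and
  \<open>x + t y\<close>, which vanish together only at the origin. Either unipotent factor alone
  would have zero gain on a whole Lagrangian.\<close>

lemma q_shear: "t > 0 \<Longrightarrow> v \<noteq> 0 \<Longrightarrow> q v < q (shear t *v v)"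
proof -
  assume t: "t > 0" and "v \<noteq> 0"
  let ?w = "xc v + t *\<^sub>R yc v"
  have *: "q (shear t *v v) = q v + t * (yc v \<bullet> yc v + ?w \<bullet> ?w)"
    by (simp add: shear_def q_coords algebra_simps inner_commute flip: matrix_vector_mul_assoc)
  have "yc v \<noteq> 0 \<or> ?w \<noteq> 0"
    using \<open>v \<noteq> 0\<close> dvec_eqI[of v 0] by auto
  then have "yc v \<bullet> yc v + ?w \<bullet> ?w > 0"
    by (metis add_nonneg_pos add_pos_nonneg inner_ge_zero inner_gt_zero_iff)
  with t show ?thesis unfolding * by simp
qed

section \<open>Continuity of matrix expressions, and strict growth of \<open>q\<close> under
  \<open>G_pos\<close>\<close>

lemma continuous_on_block [continuous_intros]:
  assumes "continuous_on S A" "continuous_on S B" "continuous_on S C" "continuous_on S D"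
  shows "continuous_on S (\<lambda>t. block (A t) (B t) (C t) (D t))"
proof -
  have "continuous_on S (\<lambda>t. block (A t) (B t) (C t) (D t) $ r $ c)" for r c
    using assms by (cases r; cases c) (simp_all add: block_def continuous_intros)
  then have "continuous_on S (\<lambda>t. \<chi> r c. block (A t) (B t) (C t) (D t) $ r $ c)"
    by (intro continuous_on_vec_lambda)
  then show ?thesis by simp
qed

lemma continuous_on_mat [continuous_intros]:
  "continuous_on S f \<Longrightarrow> continuous_on S (\<lambda>t. mat (f t) :: real^'n^'n)"
  unfolding mat_def 
proof (intro continuous_on_vec_lambda)
  show "continuous_on S (\<lambda>t. if i = j then f t else 0)" if "continuous_on S f" for i j :: 'n
    using that by (cases "i = j") simp_all
qed

lemma continuous_on_transpose [continuous_intros]: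
  fixes f :: "'a::topological_space \<Rightarrow> real^'b^'c"
  shows "continuous_on S f \<Longrightarrow> continuous_on S (\<lambda>t. transpose (f t))"
  unfolding transpose_def by (intro continuous_on_vec_lambda continuous_intros)

lemma continuous_on_matrix_mult [continuous_intros]:
  fixes f :: "'a::topological_space \<Rightarrow> real^'b^'c" and g :: "'a \<Rightarrow> real^'d^'b"
  assumes "continuous_on S f" "continuous_on S g"
  shows "continuous_on S (\<lambda>t. f t ** g t)"
  unfolding matrix_matrix_mult_def using assms
  by (intro continuous_on_vec_lambda continuous_intros)

lemma continuous_on_matrix_vector_mult [continuous_intros]:
  fixes f :: "'a::topological_space \<Rightarrow> real^'b^'c" and g :: "'a \<Rightarrow> real^'b"
  assumes "continuous_on S f" "continuous_on S g"
  shows "continuous_on S (\<lambda>t. f t *v g t)"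
  unfolding matrix_vector_mult_def using assms
  by (intro continuous_on_vec_lambda continuous_intros)

lemma continuous_on_shear: "continuous_on S shear" and continuous_on_unshear: "continuous_on S unshear"
  unfolding shear_def unshear_def by (intro continuous_intros)+

lemma shear_0 [simp]: "shear 0 = mat 1" and unshear_0 [simp]: "unshear 0 = mat 1"
  by (rule matrix_eqI, rule dvec_eqI; simp add: shear_def unshear_def flip: matrix_vector_mul_assoc)+

lemma q_G_pos:
  assumes "g \<in> G_pos" "v \<noteq> 0" "q v \<ge> 0"
  shows "q (g *v v) > 0"
proof -
  obtain W where W: "open W" "g \<in> W" "g \<in> Sp" "Sp \<inter> W \<subseteq> G_nonneg"
    using assms(1) unfolding G_pos_def interior_of_def by (auto simp: openin_open)
  \<comment> \<open>Interiority is used here: for small positive t the matrix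
    \<open>unshear t ** g\<close> is symplectic and close to \<open>g\<close>, hence still in the
    semigroup. It keeps \<open>q\<close> non-negative, and the remaining factor
    \<open>shear t\<close> makes it positive.\<close>
  have "continuous (at (0::real)) (\<lambda>t. unshear t ** g)"
    using continuous_on_matrix_mult[OF continuous_on_unshear continuous_on_const, of UNIV g]
    by (simp add: continuous_on_eq_continuous_within)
  then have "((\<lambda>t. unshear t ** g) \<longlongrightarrow> g) (at_right 0)"
    by (auto simp: isCont_def intro: tendsto_mono[OF at_le])
  then have "\<forall>\<^sub>F t in at_right 0. unshear t ** g \<in> W"
    using W(1,2) by (rule topological_tendstoD)
  then have "\<forall>\<^sub>F t in at_right (0::real). unshear t ** g \<in> W \<and> t > 0"
    by (intro eventually_conj eventually_at_right_less)
  then obtain t where t: "unshear t ** g \<in> W" "t > 0"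
    using eventually_happens'[OF trivial_limit_at_right_real] by blast
  let ?w = "unshear t ** g *v v"
  have gv: "shear t *v ?w = g *v v"
    by (simp add: shear_unshear flip: matrix_vector_mul_assoc)
  have "unshear t ** g \<in> G_nonneg"
    using t W Sp_mult unshear_in_Sp by blast
  then have "q ?w \<ge> 0"
    using q_G_nonneg_mono assms(3) order_trans by blast
  have "g *v v \<noteq> 0"
    using Sp_mult_eq_0 W(3) assms(2) by blast
  then have "?w \<noteq> 0" using gv by force
  from q_shear[OF t(2) this] \<open>q ?w \<ge> 0\<close> show ?thesis by (simp add: gv)
qed


subsection \<open>An open subset of the semigroup\<close>

definition upper_left :: "'n::finite dmat \<Rightarrow> real^'n^'n" where
  "upper_left g = (\<chi> i j. g $ Inl i $ Inl j)"

definition upper_right :: "'n::finite dmat \<Rightarrow> real^'n^'n" where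
  "upper_right g = (\<chi> i j. g $ Inl i $ Inr j)"

definition lower_left :: "'n::finite dmat \<Rightarrow> real^'n^'n" where
  "lower_left g = (\<chi> i j. g $ Inr i $ Inl j)"

lemma blocks_of_block [simp]:
  "upper_left (block A B C D) = A" "upper_right (block A B C D) = B" "lower_left (block A B C D) = C"
  by (simp_all add: upper_left_def upper_right_def lower_left_def block_def vec_eq_iff)

lemma continuous_on_blocks [continuous_intros]:
  assumes "continuous_on S f"
  shows "continuous_on S (\<lambda>t. upper_left (f t))" "continuous_on S (\<lambda>t. upper_right (f t))"
    "continuous_on S (\<lambda>t. lower_left (f t))"
  unfolding upper_left_def upper_right_def lower_left_def
  by (intro continuous_on_vec_lambda continuous_intros assms)+

text \<open>By the tube lemma, compactness of K provides one neighbourhood of \<open>g\<close> that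
  serves all z at once. This is what makes positive definiteness an open condition.\<close>

lemma open_Collect_pos_on_compact:
  fixes f :: "'a::topological_space \<times> 'b::topological_space \<Rightarrow> real"
  assumes "compact K" "continuous_on UNIV f"
  shows "open {g. \<forall>z\<in>K. f (g, z) > 0}"
proof (subst open_subopen, intro ballI)
  fix g assume g: "g \<in> {g. \<forall>z\<in>K. f (g, z) > 0}"
  have "open {p. 0 < f p}" using assms(2) by (intro open_Collect_less continuous_on_const)
  moreover have "{g} \<times> K \<subseteq> {p. 0 < f p}" using g by auto
  ultimately obtain U where "g \<in> U" "open U" "U \<times> K \<subseteq> {p. 0 < f p}"
    using Elementary_Topology.tube_lemma[OF assms(1), of "{p. 0 < f p}" g] by blast
  then show "\<exists>U. open U \<and> g \<in> U \<and> U \<subseteq> {g. \<forall>z\<in>K. f (g, z) > 0}" by blast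
qed

text \<open>Homogeneity of degree two reduces positivity to the unit sphere, where compactness is
  available.\<close>

lemma pos_form_on_sphere_iff:
  fixes A B :: "real^'n^'m"
  shows "(\<forall>z\<in>sphere 0 1. (A *v z) \<bullet> (B *v z) > 0) \<longleftrightarrow> (\<forall>z. z \<noteq> 0 \<longrightarrow> (A *v z) \<bullet> (B *v z) > 0)"
proof (intro iffI allI impI ballI)
  fix z :: "real^'n"
  assume *: "\<forall>z\<in>sphere 0 1. (A *v z) \<bullet> (B *v z) > 0" and "z \<noteq> 0"
  then have "(1 / norm z) *\<^sub>R z \<in> sphere 0 1" by simp
  with * have "(A *v ((1 / norm z) *\<^sub>R z)) \<bullet> (B *v ((1 / norm z) *\<^sub>R z)) > 0" by blast
  then show "(A *v z) \<bullet> (B *v z) > 0"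
    using \<open>z \<noteq> 0\<close> by (simp add: matrix_vector_mult_scaleR zero_less_mult_iff zero_less_divide_iff)
next
  fix z :: "real^'n"
  assume "\<forall>z. z \<noteq> 0 \<longrightarrow> (A *v z) \<bullet> (B *v z) > 0" "z \<in> sphere 0 1"
  then show "(A *v z) \<bullet> (B *v z) > 0" by (metis norm_zero dist_0_norm mem_sphere zero_neq_one)
qed

text \<open>
  For \<open>g = u\<^sup>o\<^sup>p\<^sup>p(N) l(A) u(M)\<close> the blocks satisfy \<open>C = N A\<close> and \<open>B = A M\<close>, so the last two assumptions say
  that \<open>A\<^sup>T N A\<close> and \<open>A M A\<^sup>T\<close> are positive definite; stated this way they involve no inverse and are
  visibly open in \<open>g\<close>.
\<close>

lemma block_in_G_nonneg:
  fixes A B C D :: "real^'n::finite^'n"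
  assumes Sp: "block A B C D \<in> Sp" and A: "det A > 0"
    and C: "\<And>z. z \<noteq> 0 \<Longrightarrow> (A *v z) \<bullet> (C *v z) > 0"
    and B: "\<And>z. z \<noteq> 0 \<Longrightarrow> (transpose A *v z) \<bullet> (transpose B *v z) > 0"
  shows "block A B C D \<in> G_nonneg"
proof -
  define A1 where "A1 = matrix_inv A"
  define A' where "A' = matrix_inv (transpose A)"
  have "invertible A" using A by (simp add: invertible_det_nz)
  have "A ** A1 = mat 1" unfolding A1_def by (rule matrix_inv_right) fact
  then have AA1: "A *v (A1 *v x) = x" for x by (simp add: matrix_vector_mul_assoc)
  have "A1 ** A = mat 1" using \<open>A ** A1 = mat 1\<close> by (simp add: matrix_left_right_inverse)
  then have A1A: "A1 *v (A *v x) = x" for x by (simp add: matrix_vector_mul_assoc)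
  have "transpose A ** A' = mat 1"
    unfolding A'_def by (rule matrix_inv_right) (use A in \<open>simp add: invertible_det_nz\<close>)
  then have trA': "transpose A *v (A' *v x) = x" for x
    by (simp only: matrix_vector_mul_assoc matrix_vector_mul_lid)
  have AA': "(A *v x) \<bullet> (A' *v y) = x \<bullet> y" for x y
    unfolding A'_def by (rule inner_matrix_inv_transpose) fact
  \<comment> \<open>The symplectic condition in blocks. Setting two of the four vectors to 0
    extracts its three cases: \<open>transpose A ** C\<close> and \<open>transpose B ** D\<close>
    are symmetric, and \<open>transpose A ** D - transpose C ** B\<close> is the identity.\<close>
  have S: "(A *v x + B *v y) \<bullet> (C *v x' + D *v y') - (C *v x + D *v y) \<bullet> (A *v x' + B *v y')
    = x \<bullet> y' - y \<bullet> x'" for x y x' y'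
  proof -
    obtain v :: "'n dvec" where v: "xc v = x" "yc v = y" by (rule dvec_with_coords)
    obtain w :: "'n dvec" where w: "xc w = x'" "yc w = y'" by (rule dvec_with_coords)
    have "omega (block A B C D *v v) (block A B C D *v w) = omega v w" using Sp by (simp add: Sp_def)
    then show ?thesis by (simp add: omega_coords v w)
  qed
  have S1: "(A *v x) \<bullet> (C *v x') = (C *v x) \<bullet> (A *v x')" for x x' using S[of x 0 x' 0] by simp
  have S2: "(B *v y) \<bullet> (D *v y') = (D *v y) \<bullet> (B *v y')" for y y' using S[of 0 y 0 y'] by simp
  have S3: "(A *v x) \<bullet> (D *v y) - (C *v x) \<bullet> (B *v y) = x \<bullet> y" for x y using S[of x 0 0 y] by simp
  define N where "N = C ** A1"
  define M where "M = A1 ** B"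
  have N: "N *v u = C *v (A1 *v u)" for u by (simp add: N_def matrix_vector_mul_assoc)
  have M: "M *v u = A1 *v (B *v u)" for u by (simp add: M_def matrix_vector_mul_assoc)
  have N_sym: "(N *v u) \<bullet> w = u \<bullet> (N *v w)" for u w
    using S1[of "A1 *v u" "A1 *v w"] by (simp add: N AA1)
  have S5: "(A *v x) \<bullet> (D *v y - N *v (B *v y)) = x \<bullet> y" for x y
    using S3[of x y] N_sym[of "A *v x" "B *v y"] by (simp add: inner_diff_right N A1A)
  \<comment> \<open>The remaining block is forced by the other three, which is what lets the
    factorization close.\<close>
  have D: "D *v y = N *v (B *v y) + A' *v y" for y
  proof -
    have "\<forall>u. u \<bullet> (D *v y - N *v (B *v y)) = u \<bullet> (A' *v y)"
    proof
      show "u \<bullet> (D *v y - N *v (B *v y)) = u \<bullet> (A' *v y)" for u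
        using S5[of "A1 *v u" y] AA'[of "A1 *v u" y] by (simp add: AA1)
    qed
    then have "D *v y - N *v (B *v y) = A' *v y" by (simp only: vector_eq_ldot)
    then show ?thesis by (simp add: algebra_simps)
  qed
  \<comment> \<open>Symmetry of M: \<open>S5\<close> at \<open>M *v y\<close> rewrites the form
    through B and D, where \<open>S2\<close> and the symmetry of N apply.\<close>
  have "(M *v y) \<bullet> y' = y \<bullet> (M *v y')" for y y'
  proof -
    have "(M *v y) \<bullet> y' = (B *v y) \<bullet> (D *v y' - N *v (B *v y'))" for y y'
      using S5[of "M *v y" y'] by (simp add: M AA1)
    from this[of y y'] this[of y' y] show ?thesis
      using S2[of y y'] N_sym[of "B *v y" "B *v y'"] by (simp add: inner_diff_right inner_commute)
  qed
  moreover have "x \<bullet> (M *v x) \<ge> 0" for x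
  proof -
    \<comment> \<open>Substituting \<open>x = transpose A *v z\<close> turns the form of M into the
      form assumed positive in B.\<close>
    define z where "z = A' *v x"
    have "x \<bullet> (M *v x) = (transpose A *v z) \<bullet> (M *v x)" by (simp only: z_def trA')
    also have "\<dots> = (transpose B *v z) \<bullet> x" by (simp only: inner_transpose M AA1)
    also have "\<dots> = (transpose A *v z) \<bullet> (transpose B *v z)" by (simp only: z_def trA' inner_commute)
    also have "\<dots> \<ge> 0" using B[of z] by (cases "z = 0") auto
    finally show ?thesis .
  qed
  ultimately have "sym_pos_semidef M" by (simp add: sym_pos_semidef_def symmetricI)
  then have MG: "block (mat 1) M 0 (mat 1) \<in> G_nonneg"
    by (intro G_nonneg.generator) (auto simp: U_nonneg_def)
  have "u \<bullet> (N *v u) \<ge> 0" for u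
    using C[of "A1 *v u"] by (cases "A1 *v u = 0") (auto simp: N AA1)
  then have "sym_pos_semidef N" by (simp add: sym_pos_semidef_def symmetricI N_sym)
  then have NG: "block (mat 1) 0 N (mat 1) \<in> G_nonneg"
    by (intro G_nonneg.generator) (auto simp: Uopp_nonneg_def)
  have AG: "block A 0 0 A' \<in> G_nonneg"
    using A by (intro G_nonneg.generator) (auto simp: L_Theta_def A'_def)
  have "block A B C D = block (mat 1) 0 N (mat 1) ** (block A 0 0 A' ** block (mat 1) M 0 (mat 1))"
    by (rule matrix_eqI, rule dvec_eqI)
      (simp_all add: M N D AA1 A1A matrix_vector_right_distrib flip: matrix_vector_mul_assoc)
  then show ?thesis by (simp add: G_nonneg.mult NG AG MG)
qed

text \<open>The three positivity conditions define open sets of matrices, and symplectic matrices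
  satisfying them lie in the semigroup by \<open>block_in_G_nonneg\<close>; so each such matrix is
  an interior point.\<close>

lemma block_in_G_pos:
  fixes A B C D :: "real^'n::finite^'n"
  assumes "block A B C D \<in> Sp" "det A > 0"
    and "\<And>z. z \<noteq> 0 \<Longrightarrow> (A *v z) \<bullet> (C *v z) > 0"
    and "\<And>z. z \<noteq> 0 \<Longrightarrow> (transpose A *v z) \<bullet> (transpose B *v z) > 0"
  shows "block A B C D \<in> G_pos"
proof -
  define W1 :: "'n dmat set" where "W1 = {g. 0 < det (upper_left g)}"
  define W2 :: "'n dmat set" where
    "W2 = {g. \<forall>z\<in>sphere 0 1. (upper_left g *v z) \<bullet> (lower_left g *v z) > 0}"
  define W3 :: "'n dmat set" where
    "W3 = {g. \<forall>z\<in>sphere 0 1. (transpose (upper_left g) *v z) \<bullet> (transpose (upper_right g) *v z) > 0}"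
  have "open W1" unfolding W1_def det_def
    by (intro open_Collect_less continuous_intros)
  moreover have "open W2"
    using open_Collect_pos_on_compact[OF compact_sphere[of 0 1],
      of "\<lambda>p::'n dmat \<times> (real^'n). (upper_left (fst p) *v snd p) \<bullet> (lower_left (fst p) *v snd p)"]
    by (simp add: W2_def continuous_intros)
  moreover have "open W3"
    using open_Collect_pos_on_compact[OF compact_sphere[of 0 1],
      of "\<lambda>p::'n dmat \<times> (real^'n). (transpose (upper_left (fst p)) *v snd p) \<bullet> (transpose (upper_right (fst p)) *v snd p)"]
    by (simp add: W3_def continuous_intros del: transpose_matrix_vector)
  ultimately have "openin (top_of_set Sp) (Sp \<inter> (W1 \<inter> W2 \<inter> W3))"
    by (intro openin_open_Int open_Int)
  moreover have "Sp \<inter> (W1 \<inter> W2 \<inter> W3) \<subseteq> G_nonneg"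
  proof
    fix g :: "'n dmat" assume g: "g \<in> Sp \<inter> (W1 \<inter> W2 \<inter> W3)"
    obtain A B C D where "g = block A B C D" by (rule block_surj)
    with g show "g \<in> G_nonneg"
      by (auto simp: W1_def W2_def W3_def pos_form_on_sphere_iff simp del: transpose_matrix_vector
          intro!: block_in_G_nonneg)
  qed
  moreover have "block A B C D \<in> Sp \<inter> (W1 \<inter> W2 \<inter> W3)"
    using assms by (simp add: W1_def W2_def W3_def pos_form_on_sphere_iff del: transpose_matrix_vector)
  ultimately show ?thesis
    unfolding G_pos_def interior_of_def by blast
qed

text \<open>The matrix is the product of the lower unipotent of N and the upper unipotent of the
  identity. It sends \<open>(x, 0)\<close> to \<open>(x, N x)\<close>, so it carries
  \<open>L_0\<close> onto the graph of N.\<close>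

lemma graph_in_G_pos:
  fixes N :: "real^'n::finite^'n"
  assumes "transpose N = N" "\<And>z. z \<noteq> 0 \<Longrightarrow> z \<bullet> (N *v z) > 0"
  shows "block (mat 1) (mat 1) N (N + mat 1) \<in> G_pos"
proof (rule block_in_G_pos)
  have "block (mat 1) (mat 1) N (N + mat 1) = block (mat 1) 0 N (mat 1) ** block (mat 1) (mat 1) 0 (mat 1)"
    by (rule matrix_eqI, rule dvec_eqI)
      (simp_all add: algebra_simps flip: matrix_vector_mul_assoc)
  then show "block (mat 1) (mat 1) N (N + mat 1) \<in> Sp"
    using assms(1) by (simp add: Sp_mult upper_in_Sp lower_in_Sp)
qed (use assms in auto)


subsection \<open>Positive isotropic subspaces\<close>

lemma positive_isotropic_in_graph:
  fixes V :: "'n::finite dvec set"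
  assumes V: "subspace V" "isotropic V" and pos: "\<And>v. v \<in> V \<Longrightarrow> v \<noteq> 0 \<Longrightarrow> q v > 0"
  obtains N :: "real^'n^'n" where "transpose N = N" "\<And>x. x \<noteq> 0 \<Longrightarrow> x \<bullet> (N *v x) > 0"
    "\<And>v. v \<in> V \<Longrightarrow> N *v xc v = yc v"
proof -
  have "inj_on xc V"
  proof (rule inj_onI)
    fix v w assume vw: "v \<in> V" "w \<in> V" "xc v = xc w"
    then have "q (v - w) = 0" by (simp add: q_coords)
    then show "v = w" using pos[of "v - w"] vw V(1) subspace_diff by fastforce
  qed
  \<comment> \<open>G is defined on the whole space but takes values in V, so the properties of V
    apply to every \<open>G x\<close>.\<close>
  then obtain G where G: "range G \<subseteq> V" "linear G" "\<And>v. v \<in> V \<Longrightarrow> G (xc v) = v"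
    using linear_exists_left_inverse_on[OF linear_xc V(1)] by metis
  define P where "P = matrix (xc \<circ> G)"
  define T where "T = matrix (yc \<circ> G)"
  have P: "P *v x = xc (G x)" and T: "T *v x = yc (G x)" for x
    unfolding P_def T_def using G(2) by (simp_all add: matrix_works linear_compose)
  have GV: "G x \<in> V" for x using G(1) by blast
  have sym: "xc v \<bullet> yc w = yc v \<bullet> xc w" if "v \<in> V" "w \<in> V" for v w
    using V(2) that by (simp add: isotropic_def omega_coords)
  \<comment> \<open>Coercivity of \<open>q\<close> on V, from its minimum on the unit sphere of V;
    for trivial V that sphere is empty and any positive constant works. The size of m fixes the
    coefficient \<open>2 / m\<close> in N.\<close>
  obtain m where m: "m > 0" "\<And>v. v \<in> V \<Longrightarrow> m * (v \<bullet> v) \<le> q v"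
  proof (cases "V \<subseteq> {0}")
    case True
    then have "1 * (v \<bullet> v) \<le> q v" if "v \<in> V" for v using that by (auto simp: q_coords)
    then show ?thesis using that[of 1] by simp
  next
    case False
    then obtain w where w: "w \<in> V" "w \<noteq> 0" by blast
    have "compact (V \<inter> sphere 0 1)"
      using V(1) by (simp add: closed_Int_compact closed_subspace)
    moreover have "(1 / norm w) *\<^sub>R w \<in> V \<inter> sphere 0 1"
      using w V(1) by (simp add: subspace_scale)
    moreover have "continuous_on (V \<inter> sphere 0 1) q"
      unfolding q_coords xc_def yc_def by (intro continuous_intros continuous_on_vec_lambda)
    ultimately obtain u where u: "u \<in> V \<inter> sphere 0 1" "\<And>v. v \<in> V \<inter> sphere 0 1 \<Longrightarrow> q u \<le> q v"
      using continuous_attains_inf by (metis empty_iff)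
    show ?thesis
    proof (rule that)
      show "q u > 0" using u(1) pos[of u] by (cases "u = 0") auto
      fix v assume "v \<in> V"
      show "q u * (v \<bullet> v) \<le> q v"
      proof (cases "v = 0")
        case False
        then have "(1 / norm v) *\<^sub>R v \<in> V \<inter> sphere 0 1"
          using \<open>v \<in> V\<close> V(1) by (simp add: subspace_scale)
        then have "q u \<le> q ((1 / norm v) *\<^sub>R v)" by (rule u(2))
        also have "\<dots> = q v / (v \<bullet> v)" by (simp add: q_coords power2_norm_eq_inner[symmetric] power2_eq_square)
        finally show ?thesis using False by (simp add: field_simps)
      qed (simp add: q_coords)
    qed
  qed
  \<comment> \<open>\<open>P\<close> is a projection onto \<open>xc ` V\<close>, and \<open>V\<close> is the graph of \<open>T\<close> over it. The first three terms of \<open>N\<close>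
    form the symmetric extension of \<open>T\<close>; the last one vanishes on \<open>xc ` V\<close> and is
    large enough to complete the square.\<close>
  define R where "R = mat 1 - P"
  define N where "N = T + transpose T - transpose P ** T + (2 / m) *\<^sub>R (transpose R ** R)"
  have R: "R *v x = x - xc (G x)" for x by (simp add: R_def P algebra_simps)
  have form: "z \<bullet> (N *v x) = z \<bullet> yc (G x) + yc (G z) \<bullet> x - xc (G z) \<bullet> yc (G x)
      + 2 / m * ((z - xc (G z)) \<bullet> (x - xc (G x)))" for z x
  proof -
    have "z \<bullet> (N *v x) = z \<bullet> (T *v x) + z \<bullet> (transpose T *v x) - z \<bullet> (transpose P *v (T *v x))
        + 2 / m * (z \<bullet> (transpose R *v (R *v x)))"
      unfolding N_def
      by (simp only: matrix_vector_mult_add_rdistrib matrix_vector_mult_diff_rdistrib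
          inner_add_right inner_diff_right inner_scaleR_right scaleR_matrix_vector_assoc[symmetric]
          matrix_vector_mul_assoc[symmetric])
    also have "z \<bullet> (transpose T *v x) = (T *v z) \<bullet> x" by (metis inner_commute inner_transpose)
    also have "z \<bullet> (transpose P *v (T *v x)) = (P *v z) \<bullet> (T *v x)" by (metis inner_commute inner_transpose)
    also have "z \<bullet> (transpose R *v (R *v x)) = (R *v z) \<bullet> (R *v x)" by (metis inner_commute inner_transpose)
    finally show ?thesis by (simp only: P T R)
  qed
  show ?thesis
  proof
    show "transpose N = N"
    proof (rule symmetricI)
      show "(N *v x) \<bullet> y = x \<bullet> (N *v y)" for x y
        using form[of y x] form[of x y] sym[OF GV GV, of x y] by (simp add: inner_commute)
    qed
    show "N *v xc v = yc v" if "v \<in> V" for v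
    proof -
      have "\<forall>z. z \<bullet> (N *v xc v) = z \<bullet> yc v"
      proof
        show "z \<bullet> (N *v xc v) = z \<bullet> yc v" for z
          using form[of z "xc v"] sym[OF GV that, of z] by (simp add: G(3)[OF that] inner_commute)
      qed
      then show ?thesis by (simp only: vector_eq_ldot)
    qed
    show "x \<bullet> (N *v x) > 0" if "x \<noteq> 0" for x
    proof -
      define v where "v = G x"
      define b where "b = x - xc v"
      have x: "x = xc v + b" by (simp add: b_def)
      have "x \<bullet> (N *v x) = q v + 2 * (b \<bullet> yc v) + 2 / m * (b \<bullet> b)"
        using form[of x x] by (simp add: v_def[symmetric] b_def[symmetric])
          (simp add: x q_coords inner_add_left inner_add_right inner_commute)
      moreover have "m * (v \<bullet> v) \<le> q v" using m(2) GV by (simp add: v_def)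
      moreover have "yc v \<bullet> yc v \<le> v \<bullet> v" by (simp add: inner_coords)
      then have "m * (yc v \<bullet> yc v) \<le> m * (v \<bullet> v)" using m(1) by simp
      \<comment> \<open>One half of \<open>2 / m\<close> completes the square against the cross
        term, using \<open>m * (yc v \<bullet> yc v) \<le> q v\<close>; the other half survives as
        the lower bound \<open>b \<bullet> b / m\<close>.\<close>
      moreover have "(b + m *\<^sub>R yc v) \<bullet> (b + m *\<^sub>R yc v) / m \<ge> 0" using m(1) by simp
      then have "b \<bullet> b / m + 2 * (b \<bullet> yc v) + m * (yc v \<bullet> yc v) \<ge> 0"
        using m(1) by (simp add: inner_add_left inner_add_right inner_commute field_simps)
      ultimately have *: "x \<bullet> (N *v x) \<ge> b \<bullet> b / m" by simp
      show ?thesis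
      proof (cases "b = 0")
        case True
        then have "x \<bullet> (N *v x) = q v"
          using \<open>x \<bullet> (N *v x) = q v + 2 * (b \<bullet> yc v) + 2 / m * (b \<bullet> b)\<close> by simp
        moreover have "v \<noteq> 0" using that x True by auto
        ultimately show ?thesis using pos GV by (simp add: v_def)
      next
        case False
        then have "b \<bullet> b / m > 0" using m(1) by simp
        with * show ?thesis by linarith
      qed
    qed
  qed
qed

subsection \<open>Continuity of orthogonal projections\<close>

text \<open>Orthogonality follows from the variational inequality for the closest point p, applied
  to both \<open>p + z\<close> and \<open>p - z\<close>.\<close>

lemma closest_point_subspace:
  fixes V :: "'a::euclidean_space set"
  assumes "subspace V"
  shows "closest_point V a \<in> V" "z \<in> V \<Longrightarrow> (a - closest_point V a) \<bullet> z = 0"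
proof -
  have cl: "closed V" "convex V" "V \<noteq> {}"
    using assms by (auto simp: closed_subspace subspace_imp_convex dest: subspace_0)
  show c: "closest_point V a \<in> V" using cl by (simp add: closest_point_in_set)
  assume "z \<in> V"
  then have "closest_point V a + z \<in> V" "closest_point V a - z \<in> V"
    using c assms by (simp_all add: subspace_add subspace_diff)
  from this[THEN closest_point_dot[OF cl(2,1), of _ a]] show "(a - closest_point V a) \<bullet> z = 0" by simp
qed

lemma closest_point_subspace_eqI:
  fixes V :: "'a::euclidean_space set"
  assumes "subspace V" "p \<in> V" "\<And>z. z \<in> V \<Longrightarrow> (a - p) \<bullet> z = 0"
  shows "closest_point V a = p"
proof -
  let ?d = "closest_point V a - p"
  have "?d \<in> V" using assms by (simp add: closest_point_subspace subspace_diff)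
  then have "(a - p) \<bullet> ?d - (a - closest_point V a) \<bullet> ?d = 0"
    using assms closest_point_subspace(2) by fastforce
  then have "?d \<bullet> ?d = 0" by (simp add: algebra_simps)
  then show ?thesis by simp
qed

lemma linear_closest_point:
  fixes V :: "'a::euclidean_space set"
  assumes "subspace V"
  shows "linear (closest_point V)"
proof (rule linearI)
  note closest_point_subspace[OF assms, simp]
  show "closest_point V (a + b) = closest_point V a + closest_point V b" for a b
  proof (rule closest_point_subspace_eqI)
    show "(a + b - (closest_point V a + closest_point V b)) \<bullet> z = 0" if "z \<in> V" for z
      using closest_point_subspace(2)[OF assms that, of a] closest_point_subspace(2)[OF assms that, of b]
      by (simp add: algebra_simps)
  qed (simp_all add: assms subspace_add)
  show "closest_point V (r *\<^sub>R a) = r *\<^sub>R closest_point V a" for r a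
    by (rule closest_point_subspace_eqI)
      (simp_all add: assms subspace_scale flip: scaleR_diff_right)
qed

lemma norm_closest_point_subspace:
  fixes V :: "'a::euclidean_space set"
  assumes "subspace V"
  shows "norm (closest_point V a) \<le> norm a" "norm (a - closest_point V a) \<le> norm a"
proof -
  let ?p = "closest_point V a"
  have "(a - ?p) \<bullet> ?p = 0" using assms by (simp add: closest_point_subspace)
  then have "a \<bullet> a = ?p \<bullet> ?p + (a - ?p) \<bullet> (a - ?p)" by (simp add: algebra_simps inner_commute)
  then show "norm ?p \<le> norm a" "norm (a - ?p) \<le> norm a" by (simp_all add: norm_le)
qed

text \<open>Split u into a in V and b orthogonal to V. Projecting a to the image moves it by at most
  \<open>norm (h a - a)\<close>, which contributes e; the projection of b contributes 2e.\<close>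

lemma closest_point_linear_image_close:
  fixes h :: "'a::euclidean_space \<Rightarrow> 'a"
  assumes V: "subspace V" and h: "linear h" "\<And>v. norm (h v - v) \<le> e * norm v" and e: "0 \<le> e" "e \<le> 1/2"
  shows "norm (closest_point (h ` V) u - closest_point V u) \<le> 3 * e * norm u"
proof -
  let ?W = "h ` V"
  have W: "subspace ?W" using V h(1) by (simp add: linear_subspace_image)
  define a where "a = closest_point V u"
  define b where "b = u - a"
  define w where "w = closest_point ?W b"
  have a: "a \<in> V" "norm a \<le> norm u" and b: "norm b \<le> norm u"
    using V by (simp_all add: a_def b_def closest_point_subspace norm_closest_point_subspace)
  have "norm (closest_point ?W a - a) \<le> norm (h a - a)"
    using closest_point_le[of ?W "h a" a] a(1) W
    by (simp add: closed_subspace dist_norm norm_minus_commute)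
  also have "\<dots> \<le> e * norm u" using h(2)[of a] a(2) e(1) by (meson mult_left_mono order_trans)
  finally have 1: "norm (closest_point ?W a - a) \<le> e * norm u" .
  have "w \<in> ?W" using W by (simp add: w_def closest_point_subspace)
  then obtain c where c: "c \<in> V" "w = h c" by blast
  have "(b - w) \<bullet> w = 0" using W \<open>w \<in> ?W\<close> by (simp add: w_def closest_point_subspace)
  moreover have "b \<bullet> c = 0" using V c(1) by (simp add: a_def b_def closest_point_subspace)
  \<comment> \<open>Since b is orthogonal to c, only the small displacement \<open>h c - c\<close>
    pairs with b. Below, \<open>e \<le> 1/2\<close> bounds \<open>norm c\<close> by
    \<open>2 * norm w\<close>, and one factor \<open>norm w\<close> cancels.\<close>
  ultimately have "w \<bullet> w = (h c - c) \<bullet> b" by (simp add: c(2) algebra_simps inner_commute)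
  also have "\<dots> \<le> norm (h c - c) * norm b" by (rule norm_cauchy_schwarz)
  also have "\<dots> \<le> (e * norm c) * norm b" using h(2) by (intro mult_right_mono) auto
  also have "\<dots> \<le> (e * (2 * norm w)) * norm u"
  proof (intro mult_mono mult_left_mono b)
    have "norm c \<le> norm w + norm (h c - c)" unfolding c(2) by norm
    also have "\<dots> \<le> norm w + 1/2 * norm c"
      using h(2)[of c] mult_right_mono[OF e(2), of "norm c"] by simp
    finally show "norm c \<le> 2 * norm w" by simp
  qed (use e in auto)
  finally have "norm w * norm w \<le> norm w * (2 * e * norm u)"
    by (simp add: algebra_simps flip: power2_norm_eq_inner power2_eq_square)
  then have 2: "norm w \<le> 2 * e * norm u" using e by (cases "w = 0") auto
  have "closest_point ?W u = closest_point ?W a + w"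
    using linear_add[OF linear_closest_point[OF W], of a b] by (simp add: w_def b_def)
  then have "norm (closest_point ?W u - a) \<le> norm (closest_point ?W a - a) + norm w"
    using norm_triangle_ineq[of "closest_point ?W a - a" w] by (simp add: algebra_simps)
  with 1 2 show ?thesis by (simp add: a_def algebra_simps)
qed

lemma tendsto_projection_image:
  fixes h :: "'b \<Rightarrow> real^'m^'m"
  assumes V: "subspace V" and h: "(h \<longlongrightarrow> mat 1) F"
  shows "((\<lambda>t. matrix (closest_point ((*v) (h t) ` V))) \<longlongrightarrow> matrix (closest_point V)) F"
proof -
  \<comment> \<open>The entrywise absolute sum bounds the operator norm of
    \<open>h t - mat 1\<close>, so it can serve as the error in
    \<open>closest_point_linear_image_close\<close>.\<close>
  define e where "e = (\<lambda>t. \<Sum>i\<in>UNIV. \<Sum>j\<in>UNIV. \<bar>(h t - mat 1) $ i $ j\<bar>)"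
  have "(e \<longlongrightarrow> (\<Sum>i\<in>UNIV. \<Sum>j\<in>UNIV. \<bar>(mat 1 - mat 1 :: real^'m^'m) $ i $ j\<bar>)) F"
    unfolding e_def by (intro tendsto_intros h)
  then have e: "(e \<longlongrightarrow> 0) F" by simp
  have e_nonneg: "e t \<ge> 0" for t by (simp add: e_def sum_nonneg)
  have near: "norm (h t *v v - v) \<le> e t * norm v" for t v
  proof -
    have "norm ((h t - mat 1) *v v) \<le> onorm ((*v) (h t - mat 1)) * norm v"
      by (rule onorm) simp
    also have "\<dots> \<le> e t * norm v"
      unfolding e_def by (intro mult_right_mono onorm_le_matrix_component_sum) simp
    finally show ?thesis by (simp add: algebra_simps)
  qed
  have "((\<lambda>t. closest_point ((*v) (h t) ` V) u) \<longlongrightarrow> closest_point V u) F" for u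
  proof (rule Lim_null[THEN iffD2], rule tendsto_0_le[where K = 1])
    have "\<forall>\<^sub>F t in F. e t < 1/2" using e by (rule order_tendstoD) simp
    then show "\<forall>\<^sub>F t in F. norm (closest_point ((*v) (h t) ` V) u - closest_point V u)
        \<le> norm (3 * e t * norm u) * 1"
    proof eventually_elim
      case (elim t)
      then show ?case
        using closest_point_linear_image_close[OF V _ near e_nonneg, of t u] e_nonneg[of t] by simp
    qed
    show "((\<lambda>t. 3 * e t * norm u) \<longlongrightarrow> 0) F"
      using tendsto_mult_right[OF tendsto_mult_left[OF e, of 3], of "norm u"] by simp
  qed
  then show ?thesis
    unfolding matrix_def by (intro tendsto_vec_lambda tendsto_vec_nth)
qed


subsection \<open>Flags\<close>

text \<open>Invariance of S under nonzero scaling makes the choice of representative on a line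
  irrelevant.\<close>

lemma span_singleton_in_proj_iff:
  assumes "v \<noteq> 0" and S: "\<And>c w. w \<in> S \<Longrightarrow> c \<noteq> 0 \<Longrightarrow> c *\<^sub>R w \<in> S"
  shows "span {v} \<in> proj S \<longleftrightarrow> v \<in> S"
proof
  assume "span {v} \<in> proj S"
  then obtain w where w: "w \<in> S" "span {v} = span {w}" by (auto simp: proj_def)
  then have "v \<in> span {w}" using span_base[of v "{v}"] by simp
  then obtain c where "v = c *\<^sub>R w" by (auto simp: span_singleton)
  with assms w show "v \<in> S" by auto
qed (use assms(1) in \<open>auto simp: proj_def\<close>)

lemma q_scaleR: "q (c *\<^sub>R v) = c\<^sup>2 * q v"
  by (simp add: q_coords power2_eq_square)

lemma proj_subset_H_pos_iff: "proj V \<subseteq> H_pos \<longleftrightarrow> (\<forall>v\<in>V. v \<noteq> 0 \<longrightarrow> q v > 0)"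
proof -
  have "span {v} \<in> H_pos \<longleftrightarrow> q v > 0" if "v \<noteq> 0" for v :: "'n::finite dvec"
    unfolding H_pos_def using that by (subst span_singleton_in_proj_iff) (auto simp: q_scaleR)
  then show ?thesis by (auto simp: proj_def)
qed

lemma proj_subset_H_nonneg_iff: "proj V \<subseteq> H_nonneg \<longleftrightarrow> (\<forall>v\<in>V. q v \<ge> 0)"
proof -
  have "span {v} \<in> H_nonneg \<longleftrightarrow> q v \<ge> 0" if "v \<in> V - {0}" for v
    unfolding H_nonneg_def using that by (subst span_singleton_in_proj_iff) (auto simp: q_scaleR)
  then have "proj V \<subseteq> H_nonneg \<longleftrightarrow> (\<forall>v\<in>V - {0}. q v \<ge> 0)"
    by (simp add: proj_def image_subset_iff)
  moreover have "q 0 = 0" by (simp add: q_coords)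
  ultimately show ?thesis by (metis Diff_iff order_refl singletonD)
qed

lemma flags_image_Sp:
  assumes "g \<in> Sp" "E \<in> flags k"
  shows "map (\<lambda>V. (*v) g ` V) E \<in> flags k"
proof -
  have "isotropic ((*v) g ` V)" if "isotropic V" for V
    using that assms(1) by (auto simp: isotropic_def Sp_def)
  moreover have "dim ((*v) g ` V) = dim V" for V
    using Sp_inj[OF assms(1)] by (intro dim_image_eq) (auto intro: inj_on_subset)
  moreover have "sorted_wrt (\<lambda>V W. (*v) g ` V \<subseteq> (*v) g ` W) E"
    using assms(2) by (auto simp: flags_def intro: sorted_wrt_mono_rel[of E "(\<subseteq>)"])
  ultimately show ?thesis
    using assms(2) by (auto simp: flags_def sorted_wrt_map linear_subspace_image comp_def)
qed

lemma sorted_wrt_subset_last: "sorted_wrt (\<subseteq>) E \<Longrightarrow> V \<in> set E \<Longrightarrow> V \<subseteq> last E"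
  by (induction E rule: rev_induct) (auto simp: sorted_wrt_append)

lemma G_pos_subset_Sp: "G_pos \<subseteq> Sp"
  unfolding G_pos_def using interior_of_subset_topspace[of "top_of_set Sp"] by simp

lemma flags_pos_eq:
  fixes k :: "nat list"
  assumes "k \<noteq> []"
  shows "(flags_pos k :: 'n::finite dvec set list set) = {E \<in> flags k. \<forall>v\<in>last E. v \<noteq> 0 \<longrightarrow> q v > 0}"
    (is "_ = ?R")
proof
  show "flags_pos k \<subseteq> ?R"
  proof
    fix E :: "'n dvec set list" assume "E \<in> flags_pos k"
    then obtain g F where g: "g \<in> G_pos" and E: "E = map (\<lambda>V. (*v) g ` V) F"
      and F: "\<forall>V\<in>set F. subspace V \<and> V \<subseteq> L_0" "sorted_wrt (\<subseteq>) F" "map dim F = k"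
      by (auto simp: flags_pos_def)
    have "isotropic V" if "V \<subseteq> L_0" for V :: "'n dvec set"
      using that by (auto simp: isotropic_def omega_coords subset_eq in_L_0_iff)
    then have "F \<in> flags k" using F by (auto simp: flags_def)
    then have "E \<in> flags k" unfolding E using g G_pos_subset_Sp flags_image_Sp by blast
    moreover have "q v > 0" if v: "v \<in> last E" "v \<noteq> 0" for v
    proof -
      have "F \<noteq> []" using assms F(3) by auto
      then obtain w where w: "w \<in> last F" "v = g *v w" using v(1) by (auto simp: E last_map)
      then have "q w = 0" using F(1) \<open>F \<noteq> []\<close> last_in_set by (fastforce simp: q_coords in_L_0_iff)
      moreover have "w \<noteq> 0" using v(2) w(2) by auto
      ultimately show ?thesis using q_G_pos[OF g] w(2) by simp
    qed
    ultimately show "E \<in> ?R" by simp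
  qed
  show "?R \<subseteq> flags_pos k"
  proof
    fix E assume "E \<in> ?R"
    then have E: "\<forall>V\<in>set E. subspace V \<and> isotropic V" "sorted_wrt (\<subseteq>) E" "map dim E = k"
      and pos: "\<And>v. v \<in> last E \<Longrightarrow> v \<noteq> 0 \<Longrightarrow> q v > 0"
      by (auto simp: flags_def)
    have "E \<noteq> []" using assms E(3) by auto
    then have "last E \<in> set E" by simp
    then obtain N where N: "transpose N = N" "\<And>x. x \<noteq> 0 \<Longrightarrow> x \<bullet> (N *v x) > 0"
        "\<And>v. v \<in> last E \<Longrightarrow> N *v xc v = yc v"
      using positive_isotropic_in_graph[of "last E"] E(1) pos by metis
    define g where "g = block (mat 1) (mat 1) N (N + mat 1)"
    \<comment> \<open>The projection onto \<open>L_0\<close> along \<open>L_inf\<close>. It undoes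
      \<open>g\<close> on the graph of N, so \<open>p\<close> applied to E gives the flag in
      \<open>L_0\<close> that \<open>g\<close> carries back to E.\<close>
    define p :: "'n dmat" where "p = block (mat 1) 0 0 0"
    have gp: "g *v (p *v v) = v" if "V \<in> set E" "v \<in> V" for V v
    proof -
      have "v \<in> last E" using sorted_wrt_subset_last[OF E(2)] that by blast
      then show ?thesis by (intro dvec_eqI) (simp_all add: g_def p_def N(3))
    qed
    define F where "F = map (\<lambda>V. (*v) p ` V) E"
    have gpV: "(*v) g ` (*v) p ` V = V" if "V \<in> set E" for V
      using gp[OF that] by (force simp: image_image)
    have "g \<in> G_pos" unfolding g_def by (intro graph_in_G_pos N)
    moreover have "\<forall>V\<in>set F. subspace V \<and> V \<subseteq> L_0"
      using E(1) by (auto simp: F_def linear_subspace_image in_L_0_iff p_def)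
    moreover have "sorted_wrt (\<lambda>V W. (*v) p ` V \<subseteq> (*v) p ` W) E"
      using E(2) by (auto intro: sorted_wrt_mono_rel[of E "(\<subseteq>)"])
    then have "sorted_wrt (\<subseteq>) F" by (simp add: F_def sorted_wrt_map)
    moreover have "dim ((*v) p ` V) = dim V" if "V \<in> set E" for V
    proof (rule antisym)
      show "dim ((*v) p ` V) \<le> dim V" by (rule dim_image_le) simp
      show "dim V \<le> dim ((*v) p ` V)"
        using dim_image_le[of "(*v) g" "(*v) p ` V"] by (simp add: gpV[OF that])
    qed
    then have "map dim F = k" using E(3) by (auto simp: F_def)
    moreover have "E = map (\<lambda>V. (*v) g ` V) F" by (simp add: F_def comp_def gpV map_idI)
    ultimately show "E \<in> flags_pos k" unfolding flags_pos_def by blast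
  qed
qed

lemma flag_projection_vector_mult:
  "E \<in> flags k \<Longrightarrow> i < length k \<Longrightarrow> flag_projections E i *v v = closest_point (E ! i) v"
  by (auto simp: flag_projections_def flags_def matrix_works linear_closest_point)

lemma flags_nonneg_eq:
  fixes k :: "nat list"
  assumes "k \<noteq> []"
  shows "(flags_nonneg k :: 'n::finite dvec set list set) = {E \<in> flags k. \<forall>v\<in>last E. q v \<ge> 0}"
    (is "_ = ?R")
proof
  have top: "topspace (flag_topology k) = (flags k :: 'n dvec set list set)"
    by (simp add: flag_topology_def topspace_pullback_topology)
  have len: "length E = length k" if "E \<in> flags k" for E :: "'n dvec set list"
    using that by (auto simp: flags_def)
  \<comment> \<open>All flags of type k have the same length, so the last member sits at one fixed
    coordinate of the product topology.\<close>
  have lst: "last E = E ! (length k - 1)" if "E \<in> flags k" for E :: "'n dvec set list"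
    using len[OF that] assms by (metis last_conv_nth length_0_conv)
  show "flags_nonneg k \<subseteq> ?R"
  proof
    fix E :: "'n dvec set list" assume "E \<in> flags_nonneg k"
    then have E: "E \<in> flags k"
      and cl: "\<And>U. open U \<Longrightarrow> flag_projections E \<in> U \<Longrightarrow> \<exists>E'\<in>flags_pos k. flag_projections E' \<in> U"
      unfolding flags_nonneg_def in_closure_of top
      by (auto simp: flag_topology_def openin_pullback_topology) blast
    have "q v \<ge> 0" if v: "v \<in> last E" for v
    proof (rule ccontr)
      assume "\<not> q v \<ge> 0"
      define m where "m = length k - 1"
      have m: "m < length k" using assms by (simp add: m_def)
      \<comment> \<open>An open condition on the single coordinate m. A positive flag E' satisfying
        it would have the projection of v, a vector of its last member, with negative
        \<open>q\<close>.\<close>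
      define U where "U = {f :: nat \<Rightarrow> 'n dmat. q (f m *v v) < 0}"
      have "open U"
        unfolding U_def q_coords xc_def yc_def
        by (intro open_Collect_less continuous_intros continuous_on_vec_lambda
            continuous_on_product_coordinates)
      moreover have "flag_projections E \<in> U"
        using \<open>\<not> q v \<ge> 0\<close> v m lst[OF E] by (simp add: U_def flag_projection_vector_mult[OF E] closest_point_self m_def)
      ultimately obtain E' where E': "E' \<in> flags_pos k" "flag_projections E' \<in> U" using cl by blast
      then have E'k: "E' \<in> flags k" and pos: "\<forall>v\<in>last E'. v \<noteq> 0 \<longrightarrow> q v > 0"
        by (auto simp: flags_pos_eq[OF assms])
      have "subspace (E' ! m)" using E'k m len[OF E'k] by (auto simp: flags_def)
      then have "closest_point (E' ! m) v \<in> last E'"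
        using lst[OF E'k] by (simp add: m_def closest_point_subspace)
      moreover have "q (closest_point (E' ! m) v) < 0"
        using E'(2) m by (simp add: U_def flag_projection_vector_mult[OF E'k])
      moreover from this have "closest_point (E' ! m) v \<noteq> 0" by (auto simp: q_coords)
      ultimately show False using pos by fastforce
    qed
    with E show "E \<in> ?R" by simp
  qed
  show "?R \<subseteq> flags_nonneg k"
  proof
    fix E :: "'n dvec set list" assume "E \<in> ?R"
    then have E: "E \<in> flags k" and nonneg: "\<And>v. v \<in> last E \<Longrightarrow> q v \<ge> 0" by auto
    define Es where "Es = (\<lambda>t. map (\<lambda>V. (*v) (shear t) ` V) E)"
    have Es_pos: "Es t \<in> flags_pos k" if "t > 0" for t
    proof -
      have "E \<noteq> []" using len[OF E] assms by auto
      then have "q v > 0" if v: "v \<in> last (Es t)" "v \<noteq> 0" for v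
      proof -
        obtain w where w: "w \<in> last E" "v = shear t *v w"
          using v(1) \<open>E \<noteq> []\<close> by (auto simp: Es_def last_map)
        then have "w \<noteq> 0" using v(2) by auto
        then show ?thesis using q_shear[OF \<open>t > 0\<close>] nonneg w by (metis le_less_trans)
      qed
      then show ?thesis
        using flags_image_Sp[OF shear_in_Sp E] by (simp add: flags_pos_eq[OF assms] Es_def)
    qed
    have "continuous (at (0::real)) (shear :: real \<Rightarrow> 'n dmat)"
      using continuous_on_eq_continuous_at[OF open_UNIV] continuous_on_shear by blast
    then have shear: "((shear :: real \<Rightarrow> 'n dmat) \<longlongrightarrow> mat 1) (at_right 0)"
      by (auto simp: isCont_def intro: tendsto_mono[OF at_le])
    \<comment> \<open>Convergence in the product is checked coordinatewise; beyond the length of the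
      flag both sides are the padding value 0.\<close>
    have "((\<lambda>t. flag_projections (Es t) i) \<longlongrightarrow> flag_projections E i) (at_right 0)" for i
    proof (cases "i < length E")
      case True
      then have "subspace (E ! i)" using E by (auto simp: flags_def)
      with True show ?thesis
        using tendsto_projection_image[OF _ shear] by (simp add: flag_projections_def Es_def)
    qed (simp add: flag_projections_def Es_def)
    then have lim: "((\<lambda>t. flag_projections (Es t)) \<longlongrightarrow> flag_projections E) (at_right 0)"
      unfolding limitin_canonical_iff[symmetric] euclidean_product_topology[symmetric] limitin_componentwise
      by simp
    have "\<exists>E'\<in>flags_pos k. flag_projections E' \<in> U" if "open U" "flag_projections E \<in> U" for U
    proof -
      have "\<forall>\<^sub>F t in at_right (0::real). flag_projections (Es t) \<in> U \<and> t > 0"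
        using topological_tendstoD[OF lim that] by (intro eventually_conj eventually_at_right_less)
      then show ?thesis
        using eventually_happens'[OF trivial_limit_at_right_real] Es_pos by blast
    qed
    then show "E \<in> flags_nonneg k"
      unfolding flags_nonneg_def in_closure_of top using E
      by (fastforce simp: flag_topology_def openin_pullback_topology flags_pos_eq[OF assms])
  qed
qed

theorem corollary6p3:
  fixes k :: "nat list"
  assumes "k \<noteq> []" and "sorted_wrt (<) k" and "\<forall>j\<in>set k. 0 < j \<and> j \<le> CARD('n::finite)"
  shows "(flags_pos k :: 'n dvec set list set) = {E \<in> flags k. proj (last E) \<subseteq> H_pos}
       \<and> (flags_nonneg k :: 'n dvec set list set) = {E \<in> flags k. proj (last E) \<subseteq> H_nonneg}"
  unfolding proj_subset_H_pos_iff proj_subset_H_nonneg_iff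
  using flags_pos_eq[OF assms(1)] flags_nonneg_eq[OF assms(1)] by blast

end
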